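(* Let $n$ be a nonnegative integer. Then $\kappa_{0,\lambda}(Y)=0$, and for $n\ge 1$ $$\kappa_{n,\lambda}(Y)=\sum_{k=1}^{n}(-1)^{k-1}\lambda^{k-1}\langle 1\rangle_{k,1/\lambda}{n\brace k}_{Y,\lambda}.$$
   Context: $\lambda$ is a fixed nonzero real number. For real $x$ and real $\mu\neq 0$: $(x)_{0,\mu}=1$, $(x)_{n,\mu}=x(x-\mu)\cdots(x-(n-1)\mu)$ and $\langle x\rangle_{0,\mu}=1$, $\langle x\rangle_{n,\mu}=x(x+\mu)\cdots(x+(n-1)\mu)$ for $n\ge1$. The degenerate exponential is $e_{\lambda}^{x}(t)=(1+\lambda t)^{x/\lambda}=\sum_{n\ge0}(x)_{n,\lambda}\frac{t^n}{n!}$. The degenerate logarithm is, for $\mu\ne0$ and $u>0$, $\log_{\mu}(u)=\frac{1}{\mu}(u^{\mu}-1)$ (the compositional inverse of $e_\mu(t)=e_\mu^1(t)$); in particular $\log_{-\lambda}(u)=-\frac1\lambda(u^{-\lambda}-1)$. $Y$ is a real random variable whose degenerate moment generating functions exist near the origin: for every nonzero real $\lambda$ there is $r=r(\lambda)>0$ with $E[e_{\lambda}^{Y}(t)]=\sum_{n\ge0}E[(Y)_{n,\lambda}]\frac{t^n}{n!}$ for $|t|<r$. All generating-function identities are power series expansions at $t=0$. The numbers ${n\brace k}_{Y,\lambda}$ (probabilistic degenerate Stirling numbers of the second kind associated with $Y$) are defined by $\frac{1}{k!}\big(E[e_{\lambda}^{Y}(t)]-1\big)^k=\sum_{n\ge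 k}{n\brace k}_{Y,\lambda}\frac{t^n}{n!}$, $k\ge0$. The numbers $\kappa_{n,\lambda}(Y)$ are defined by $\log_{-\lambda}\big(E[e_{\lambda}^{Y}(t)]\big)=\sum_{n\ge0}\kappa_{n,\lambda}(Y)\frac{t^n}{n!}$. *)

theory Defs
  imports "HOL-Probability.Probability" "HOL-Analysis.FPS_Convergence"
begin

definition degenerate_falling :: "real \<Rightarrow> real \<Rightarrow> nat \<Rightarrow> real" where
  "degenerate_falling \<mu> x n = (\<Prod>i<n. x - real i * \<mu>)"

definition degenerate_rising :: "real \<Rightarrow> real \<Rightarrow> nat \<Rightarrow> real" where
  "degenerate_rising \<mu> x n = (\<Prod>i<n. x + real i * \<mu>)"

(* Meaningful for 1 + l * t > 0 only, in particular for t close to 0. *)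
definition degenerate_exp :: "real \<Rightarrow> real \<Rightarrow> real \<Rightarrow> real" where
  "degenerate_exp l x t = (1 + l * t) powr (x / l)"

definition degenerate_log :: "real \<Rightarrow> real \<Rightarrow> real" where
  "degenerate_log \<mu> u = (u powr \<mu> - 1) / \<mu>"

definition degenerate_mgf :: "'a measure \<Rightarrow> ('a \<Rightarrow> real) \<Rightarrow> real \<Rightarrow> real \<Rightarrow> real" where
  "degenerate_mgf M Y l t = integral\<^sup>L M (\<lambda>\<omega>. degenerate_exp l (Y \<omega>) t)"

(* The Bochner integral of a non-integrable function is 0, so the existence of the
   expectations has to be required explicitly.  The radius r may always be shrunk,
   so one may assume r <= 1 / |l|, where degenerate_exp is meaningful. *)
definition degenerate_mgf_exists :: "'a measure \<Rightarrow> ('a \<Rightarrow> real) \<Rightarrow> bool" where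
  "degenerate_mgf_exists M Y \<longleftrightarrow>
     (\<forall>l. l \<noteq> 0 \<longrightarrow>
        (\<forall>n. integrable M (\<lambda>\<omega>. degenerate_falling l (Y \<omega>) n)) \<and>
        (\<exists>r>0. \<forall>t. \<bar>t\<bar> < r \<longrightarrow>
           integrable M (\<lambda>\<omega>. degenerate_exp l (Y \<omega>) t) \<and>
           (\<lambda>n. integral\<^sup>L M (\<lambda>\<omega>. degenerate_falling l (Y \<omega>) n) * t ^ n / fact n)
             sums degenerate_mgf M Y l t))"

(* The a_n in the expansion f t = (SUM n. a_n * t^n / n!), valid for t in a
   neighbourhood of 0; the expansion is unique by egf_coeff_eqI. *)
definition egf_coeff :: "(real \<Rightarrow> real) \<Rightarrow> nat \<Rightarrow> real" where
  "egf_coeff f n = fact n * fps_nth (THE F. f has_fps_expansion F) n"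

lemma has_fps_expansion_unique_real:
  fixes f :: "real \<Rightarrow> real"
  assumes "f has_fps_expansion F" "f has_fps_expansion G"
  shows "F = G"
proof (rule ccontr)
  define H where "H = F - G"
  assume "F \<noteq> G"
  then have "H \<noteq> 0" by (simp add: H_def)
  define K where "K = fps_shift (subdegree H) H"
  have K0: "fps_nth K 0 \<noteq> 0"
    using \<open>H \<noteq> 0\<close> by (simp add: K_def)
  have "(\<lambda>x. f x - f x) has_fps_expansion H"
    unfolding H_def by (intro has_fps_expansion_diff assms)
  then have H: "fps_conv_radius H > 0" "eventually (\<lambda>x. eval_fps H x = 0) (nhds 0)"
    by (auto simp: has_fps_expansion_def)
  have rK: "fps_conv_radius K > 0"
    using H(1) by (simp add: K_def)
  have HK: "H = K * fps_X ^ subdegree H"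
    by (simp add: K_def subdegree_decompose[symmetric])
  have "isCont (eval_fps K) 0"
    using has_fps_expansion_imp_continuous[OF eval_fps_has_fps_expansion[OF rK], of UNIV] by simp
  then have "(eval_fps K \<longlongrightarrow> eval_fps K 0) (at 0)"
    by (simp add: isCont_def)
  then have "eventually (\<lambda>x. eval_fps K x \<noteq> 0) (at 0)"
    using K0 by (intro tendsto_imp_eventually_ne) (auto simp: eval_fps_at_0)
  moreover have "eventually (\<lambda>x::real. x \<in> eball 0 (fps_conv_radius K)) (at 0)"
    using rK by (intro eventually_at_in_open') (auto simp: zero_ereal_def)
  moreover have "eventually (\<lambda>x. eval_fps H x = 0) (at 0)"
    using H(2) by (simp add: eventually_nhds_conv_at)
  moreover have "eventually (\<lambda>x::real. x \<noteq> 0) (at 0)"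
    by (simp add: eventually_at_filter)
  ultimately have "eventually (\<lambda>x::real. False) (at 0)"
  proof eventually_elim
    case (elim x)
    have "eval_fps H x = eval_fps K x * x ^ subdegree H"
      using elim(2) by (subst HK) (simp add: eval_fps_mult)
    then show ?case using elim by simp
  qed
  then show False by simp
qed

lemma egf_coeff_eqI:
  assumes "f has_fps_expansion F"
  shows "egf_coeff f n = fact n * fps_nth F n"
proof -
  have "(THE F. f has_fps_expansion F) = F"
  proof (rule the_equality)
    fix G assume "f has_fps_expansion G"
    then show "G = F"
      using assms by (rule has_fps_expansion_unique_real)
  qed (fact assms)
  then show ?thesis by (simp add: egf_coeff_def)
qed

(* The coefficients with n < k vanish, since degenerate_mgf M Y l 0 = 1. *)
definition prob_degenerate_stirling2 :: "'a measure \<Rightarrow> ('a \<Rightarrow> real) \<Rightarrow> real \<Rightarrow> nat \<Rightarrow> nat \<Rightarrow> real" where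
  "prob_degenerate_stirling2 M Y l n k =
     egf_coeff (\<lambda>t. 1 / fact k * (degenerate_mgf M Y l t - 1) ^ k) n"

definition degenerate_cumulant :: "'a measure \<Rightarrow> ('a \<Rightarrow> real) \<Rightarrow> real \<Rightarrow> nat \<Rightarrow> real" where
  "degenerate_cumulant M Y l n =
     egf_coeff (\<lambda>t. degenerate_log (- l) (degenerate_mgf M Y l t)) n"

end

theory Submission
  imports Defs "HOL-Complex_Analysis.Laurent_Convergence"
begin

text \<open>Let \<open>G\<close> be the expansion of the degenerate moment generating function minus
  1; it has no constant term. By the binomial series, the degenerate logarithm at 1 + u is the sum
  over k >= 1 of c_k u^k, where k! c_k is exactly the weight in the claimed formula
  (\<open>degenerate_log_fps_nth\<close>). Substituting \<open>G\<close> for u gives the sum of c_k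
  \<open>G ^ k\<close>, and \<open>G ^ k\<close> / k! generates the Stirling numbers, so comparing
  coefficients of t^n yields the result. The numbers are defined through expansions of actual
  functions, so this formal substitution must be justified analytically: that is
  \<open>has_fps_expansion_compose_real\<close>, proved by passing through complex series.\<close>

definition complexify_fps :: "real fps \<Rightarrow> complex fps" where
  "complexify_fps F = Abs_fps (\<lambda>n. complex_of_real (fps_nth F n))"

lemma complexify_fps_nth [simp]: "fps_nth (complexify_fps F) n = complex_of_real (fps_nth F n)"
  by (simp add: complexify_fps_def)

lemma complexify_fps_power: "complexify_fps (F ^ n) = complexify_fps F ^ n"
proof (induction n)
  case (Suc n)
  have "complexify_fps (F * G) = complexify_fps F * complexify_fps G" for G
    by (simp add: fps_eq_iff fps_mult_nth)
  with Suc show ?case by simp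
qed (simp add: fps_eq_iff)

lemma complexify_fps_compose: "complexify_fps (F oo G) = complexify_fps F oo complexify_fps G"
  by (simp add: fps_eq_iff fps_compose_nth flip: complexify_fps_power)

text \<open>The radius depends only on the absolute values of the coefficients, which the embedding
  preserves.\<close>

lemma fps_conv_radius_complexify [simp]: "fps_conv_radius (complexify_fps F) = fps_conv_radius F"
  by (simp add: fps_conv_radius_def conv_radius_def)

lemma eval_fps_complexify:
  assumes "ereal \<bar>t\<bar> < fps_conv_radius F"
  shows "eval_fps (complexify_fps F) (of_real t) = of_real (eval_fps F t)"
proof -
  have "summable (\<lambda>n. fps_nth F n * t ^ n)"
    using assms by (intro summable_fps) simp
  from suminf_of_real[OF this, where 'a = complex] show ?thesis
    by (simp add: eval_fps_def)
qed

text \<open>The library composes expansions over the complex numbers only, where analyticity of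
  the composite gives its convergence; the coefficients being real, this transfers.\<close>

lemma has_fps_expansion_compose_real:
  fixes f g :: "real \<Rightarrow> real"
  assumes f: "f has_fps_expansion F" and g: "g has_fps_expansion G" and "fps_nth G 0 = 0"
  shows "(\<lambda>t. f (g t)) has_fps_expansion (F oo G)"
proof -
  have radius: "fps_conv_radius F > 0" "fps_conv_radius G > 0"
    using f g by (simp_all add: has_fps_expansion_def)
  have "(eval_fps (complexify_fps F) \<circ> eval_fps (complexify_fps G))
      has_fps_expansion (complexify_fps F oo complexify_fps G)"
    using radius \<open>fps_nth G 0 = 0\<close>
    by (intro has_fps_expansion_compose eval_fps_has_fps_expansion) simp_all
  then have radius': "fps_conv_radius (F oo G) > 0"
    and ev: "\<forall>\<^sub>F z in nhds 0. eval_fps (complexify_fps (F oo G)) z =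
      eval_fps (complexify_fps F) (eval_fps (complexify_fps G) z)"
    by (simp_all add: has_fps_expansion_def flip: complexify_fps_compose)
  \<comment> \<open>The identity near 0 in the plane is restricted to the real axis.\<close>
  have "filterlim complex_of_real (nhds 0) (nhds 0)"
    using tendsto_of_real[OF filterlim_ident[of "nhds (0::real)"], where 'a = complex] by simp
  from eventually_compose_filterlim[OF ev this]
  have ev_real: "\<forall>\<^sub>F t in nhds 0. eval_fps (complexify_fps (F oo G)) (complex_of_real t) =
      eval_fps (complexify_fps F) (eval_fps (complexify_fps G) (of_real t))" .
  have in_disc: "\<forall>\<^sub>F t in nhds 0. ereal \<bar>t\<bar> < fps_conv_radius H"
    if "fps_conv_radius H > 0" for H :: "real fps"
    using eventually_nhds_in_open[OF open_eball, of "0::real" 0 "fps_conv_radius H"] that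
    by (simp add: zero_ereal_def)
  have g_eq: "\<forall>\<^sub>F t in nhds 0. eval_fps G t = g t"
    and f_eq: "\<forall>\<^sub>F u in nhds 0. eval_fps F u = f u"
    using f g by (simp_all add: has_fps_expansion_def)
  \<comment> \<open>Since \<open>g\<close> is continuous with value 0 at 0, facts about
    \<open>f\<close> and \<open>F\<close> near 0 can be pulled back along \<open>g\<close>.\<close>
  have "g 0 = 0"
    using eventually_nhds_x_imp_x[OF g_eq] \<open>fps_nth G 0 = 0\<close> by (simp add: eval_fps_at_0)
  moreover have "isCont g 0"
    using has_fps_expansion_imp_continuous[OF g, of UNIV] by simp
  ultimately have g_lim: "filterlim g (nhds 0) (nhds 0)"
    by (simp add: isCont_def tendsto_nhds_iff)
  have "\<forall>\<^sub>F t in nhds 0. eval_fps (F oo G) t = f (g t)"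
    \<comment> \<open>For t near 0 all three series are evaluated at real points inside their discs,
      so each complex value is the image of the real one, and the embedding is injective.\<close>
    using ev_real g_eq in_disc[OF radius(2)] in_disc[OF radius']
      eventually_compose_filterlim[OF f_eq g_lim]
      eventually_compose_filterlim[OF in_disc[OF radius(1)] g_lim]
  proof eventually_elim
    case (elim t)
    then have "complex_of_real (eval_fps (F oo G) t) = of_real (f (g t))"
      by (simp add: eval_fps_complexify)
    then show ?case
      by (simp only: of_real_eq_iff)
  qed
  with radius' show ?thesis
    by (simp add: has_fps_expansion_def)
qed

lemma has_fps_expansion_one_plus_powr:
  "(\<lambda>u::real. (1 + u) powr a) has_fps_expansion fps_binomial a"
proof (rule has_fps_expansionI)
  have "\<forall>\<^sub>F u in nhds (0::real). u \<in> ball 0 1"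
    by (intro eventually_nhds_in_open) auto
  then show "\<forall>\<^sub>F u in nhds 0. (\<lambda>n. fps_nth (fps_binomial a) n * u ^ n) sums (1 + u) powr a"
    by eventually_elim (simp add: gen_binomial_real)
qed

definition degenerate_log_fps :: "real \<Rightarrow> real fps" where
  "degenerate_log_fps \<mu> = fps_const (1 / \<mu>) * (fps_binomial \<mu> - 1)"

lemma degenerate_log_has_fps_expansion:
  "(\<lambda>u. degenerate_log \<mu> (1 + u)) has_fps_expansion degenerate_log_fps \<mu>"
proof -
  have "(\<lambda>u. 1 / \<mu> * ((1 + u) powr \<mu> - 1)) has_fps_expansion degenerate_log_fps \<mu>"
    unfolding degenerate_log_fps_def
    by (intro has_fps_expansion_cmult_left has_fps_expansion_diff has_fps_expansion_1
        has_fps_expansion_one_plus_powr)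
  then show ?thesis by (simp add: degenerate_log_def)
qed

lemma degenerate_log_fps_nth_0 [simp]: "fps_nth (degenerate_log_fps \<mu>) 0 = 0"
  by (simp add: degenerate_log_fps_def)

text \<open>Pulling \<open>l\<close> out of each factor, l + i = l (1 + i / l), turns the rising
  factorial of \<open>l\<close> into one of 1 with step \<open>1 / l\<close>. Dividing by
  \<open>- l\<close> then lowers both exponents to \<open>k - 1\<close>.\<close>

lemma degenerate_log_fps_nth:
  assumes "l \<noteq> 0" "k \<ge> 1"
  shows "fps_nth (degenerate_log_fps (- l)) k =
    (-1) ^ (k - 1) * l ^ (k - 1) * degenerate_rising (1 / l) 1 k / fact k"
proof -
  obtain m where k: "k = Suc m"
    using assms(2) by (cases k) auto
  have "(- l gchoose k) * fact k = (-1) ^ k * (\<Prod>i<k. l + real i)"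
    by (simp add: gbinomial_pochhammer pochhammer_prod atLeast0LessThan)
  moreover have "(\<Prod>i<k. l + real i) = l ^ k * degenerate_rising (1 / l) 1 k"
    unfolding degenerate_rising_def
    using assms(1) by (induction k) (simp_all add: field_simps)
  ultimately have "(- l gchoose k) = (-1) ^ k * l ^ k * degenerate_rising (1 / l) 1 k / fact k"
    by (simp add: field_simps)
  then show ?thesis
    using assms(1) by (simp add: degenerate_log_fps_def k)
qed

text \<open>The constant term is the expectation of an empty product, hence the total mass 1. This
  is what permits substituting the function minus 1 into a power series at 0.\<close>

lemma (in prob_space) degenerate_mgf_has_fps_expansion:
  assumes "degenerate_mgf_exists M Y" "l \<noteq> 0"
  obtains F where "degenerate_mgf M Y l has_fps_expansion F" "fps_nth F 0 = 1"
proof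
  let ?F = "Abs_fps (\<lambda>n. expectation (\<lambda>\<omega>. degenerate_falling l (Y \<omega>) n) / fact n)"
  obtain r where "r > 0" and "\<And>t. \<bar>t\<bar> < r \<Longrightarrow>
      (\<lambda>n. expectation (\<lambda>\<omega>. degenerate_falling l (Y \<omega>) n) * t ^ n / fact n)
        sums degenerate_mgf M Y l t"
    using assms unfolding degenerate_mgf_exists_def by blast
  moreover from \<open>r > 0\<close> have "\<forall>\<^sub>F t in nhds (0::real). t \<in> ball 0 r"
    by (intro eventually_nhds_in_open) auto
  ultimately show "degenerate_mgf M Y l has_fps_expansion ?F"
    by (intro has_fps_expansionI) (auto elim: eventually_mono)
  show "fps_nth ?F 0 = 1"
    by (simp add: degenerate_falling_def prob_space)
qed

theorem theorem2p1:
  fixes M :: "'a measure" and Y :: "'a \<Rightarrow> real" and l :: real and n :: nat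
  assumes "prob_space M"
    and "Y \<in> borel_measurable M"
    and "degenerate_mgf_exists M Y"
    and "l \<noteq> 0"
  shows "degenerate_cumulant M Y l 0 = 0 \<and>
    (n \<ge> 1 \<longrightarrow> degenerate_cumulant M Y l n =
      (\<Sum>k=1..n. (-1) ^ (k - 1) * l ^ (k - 1) * degenerate_rising (1 / l) 1 k
                  * prob_degenerate_stirling2 M Y l n k))"
proof -
  interpret prob_space M by fact
  let ?L = "degenerate_log_fps (- l)"
  obtain F where F: "degenerate_mgf M Y l has_fps_expansion F" "fps_nth F 0 = 1"
    using degenerate_mgf_has_fps_expansion assms(3,4) .
  define G where "G = F - 1"
  have G: "(\<lambda>t. degenerate_mgf M Y l t - 1) has_fps_expansion G"
    unfolding G_def by (intro has_fps_expansion_diff F has_fps_expansion_1)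
  have G0: "fps_nth G 0 = 0"
    by (simp add: G_def F)
  have "(\<lambda>t. degenerate_log (- l) (1 + (degenerate_mgf M Y l t - 1))) has_fps_expansion (?L oo G)"
    by (rule has_fps_expansion_compose_real[OF degenerate_log_has_fps_expansion G G0])
  then have cumulant: "degenerate_cumulant M Y l m = fact m * fps_nth (?L oo G) m" for m
    unfolding degenerate_cumulant_def by (intro egf_coeff_eqI) simp
  have stirling2: "prob_degenerate_stirling2 M Y l m k = fact m * (fps_nth (G ^ k) m / fact k)" for m k
  proof -
    have "(\<lambda>t. 1 / fact k * (degenerate_mgf M Y l t - 1) ^ k)
        has_fps_expansion fps_const (1 / fact k) * G ^ k"
      by (intro has_fps_expansion_cmult_left has_fps_expansion_power G)
    from egf_coeff_eqI[OF this] show ?thesis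
      by (simp add: prob_degenerate_stirling2_def)
  qed
  have "degenerate_cumulant M Y l n =
      (\<Sum>k=1..n. (-1) ^ (k - 1) * l ^ (k - 1) * degenerate_rising (1 / l) 1 k
                  * prob_degenerate_stirling2 M Y l n k)"
  proof -
    \<comment> \<open>The term k = 0 drops out because the logarithm series has no constant
      term.\<close>
    have "fps_nth (?L oo G) n = (\<Sum>k=1..n. fps_nth ?L k * fps_nth (G ^ k) n)"
      unfolding fps_compose_nth by (simp add: sum.atLeast_Suc_atMost)
    also have "fact n * \<dots> = (\<Sum>k=1..n. (-1) ^ (k - 1) * l ^ (k - 1) * degenerate_rising (1 / l) 1 k
                  * prob_degenerate_stirling2 M Y l n k)"
      \<comment> \<open>The factor 1 / k! of the logarithm coefficient is absorbed by the Stirling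
        number.\<close>
      unfolding sum_distrib_left
      by (intro sum.cong) (simp_all add: degenerate_log_fps_nth assms(4) stirling2)
    finally show ?thesis
      by (simp add: cumulant)
  qed
  moreover have "degenerate_cumulant M Y l 0 = 0"
    by (simp add: cumulant)
  ultimately show ?thesis by simp
qed

end
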